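(* Let $p$ and $\beta$ be real numbers with $p\ge 1$, $\beta>0$ and $p/\beta\le 2$. Then $$B(p,\beta)^{1/p}\ \le\ K_+\cdot\beta,\qquad\text{where } K_+=\exp\left[(e^2-3)/2\right].$$
   Context: The Bell function of two variables is $B(p,\beta)=e^{-\beta}\sum_{k=0}^{\infty}\frac{k^p\,\beta^k}{k!}$ for real $p>0$ and $\beta>0$. Equivalently, $B(p,\beta)={\bf E}(\tau^p)$ where $\tau$ is a Poisson random variable with parameter $\beta$. *)

theory Defs
  imports Complex_Main
begin

text \<open>
  The Bell function is meant for \<open>p > 0\<close> and \<open>\<beta> > 0\<close>; the series then converges, and
  its term at \<open>k = 0\<close> is \<open>0\<close> because \<open>0 powr p = 0\<close>.
\<close>

definition bell_fun :: "real \<Rightarrow> real \<Rightarrow> real" where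
  "bell_fun p \<beta> = exp (- \<beta>) * (\<Sum>k. real k powr p * \<beta> ^ k / fact k)"

definition K_plus :: real where
  "K_plus = exp (((exp 1)\<^sup>2 - 3) / 2)"

end

theory Submission
  imports Defs
begin

text \<open>
  The inequality \<open>x \<le> exp (x - 1)\<close> at \<open>x = k / \<beta>\<close>, raised to the power \<open>p\<close>, bounds \<open>k\<^sup>p\<close> by
  \<open>(\<beta> / e)\<^sup>p exp (t k)\<close> with \<open>t = p / \<beta>\<close>. Hence the Poisson moment is controlled by the exponential
  moment at \<open>t\<close>, and \<open>B(p, \<beta>) powr (1 / p) \<le> \<beta> exp ((exp t - 1) / t - 1)\<close>. By convexity of \<open>exp\<close> the
  exponent increases with \<open>t\<close>; its value at \<open>t = 2\<close> is \<open>(e\<^sup>2 - 3) / 2\<close>.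
\<close>

lemma powr_le_exp_linear:
  fixes x p \<beta> :: real
  assumes "x \<ge> 0" "p \<ge> 0" "\<beta> > 0"
  shows "x powr p \<le> \<beta> powr p * exp (p / \<beta> * x - p)"
proof -
  have "x / \<beta> \<le> exp (x / \<beta> - 1)"
    using exp_ge_add_one_self[of "x / \<beta> - 1"] by simp
  then have "x \<le> \<beta> * exp (x / \<beta> - 1)"
    using assms by (simp add: field_simps)
  then have "x powr p \<le> (\<beta> * exp (x / \<beta> - 1)) powr p"
    using assms by (intro powr_mono2) auto
  also have "\<dots> = \<beta> powr p * exp (p / \<beta> * x - p)"
    using assms by (simp add: powr_mult exp_powr_real algebra_simps)
  finally show ?thesis .
qed

text \<open>The factor \<open>exp (p / \<beta>) ^ k\<close> merges with \<open>\<beta> ^ k\<close>,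
  so the majorant is a constant times a term of the exponential series. It gives both the
  convergence of the Bell series and a closed form for the bound.\<close>

lemma bell_term_le:
  fixes p \<beta> :: real
  assumes "p \<ge> 0" "\<beta> > 0"
  shows "real k powr p * \<beta> ^ k / fact k
           \<le> \<beta> powr p * exp (- p) * ((\<beta> * exp (p / \<beta>)) ^ k / fact k)"
proof -
  have "exp (p / \<beta> * real k - p) = exp (- p) * exp (p / \<beta>) ^ k"
    by (simp add: mult_ac flip: exp_of_nat_mult exp_add)
  then have "real k powr p \<le> \<beta> powr p * exp (- p) * exp (p / \<beta>) ^ k"
    using powr_le_exp_linear[of "real k" p \<beta>] assms by (simp add: mult_ac)
  then have "real k powr p * (\<beta> ^ k / fact k)
               \<le> \<beta> powr p * exp (- p) * exp (p / \<beta>) ^ k * (\<beta> ^ k / fact k)"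
    using assms by (intro mult_right_mono) auto
  then show ?thesis by (simp add: power_mult_distrib mult_ac)
qed

lemma exp_power_series_sums:
  fixes c x :: real
  shows "(\<lambda>k. c * (x ^ k / fact k)) sums (c * exp x)"
  using exp_converges[of x] by (intro sums_mult) (simp add: divide_inverse mult_ac)

lemma summable_bell:
  fixes p \<beta> :: real
  assumes "p \<ge> 0" "\<beta> > 0"
  shows "summable (\<lambda>k. real k powr p * \<beta> ^ k / fact k)"
  using assms bell_term_le[OF assms]
  by (intro summable_comparison_test'[OF sums_summable[OF exp_power_series_sums], of 0]) simp

text \<open>This licenses taking the root of order \<open>p\<close> in the final estimate:
  \<open>powr_mono2\<close> asks for a nonnegative smaller base.\<close>

lemma bell_fun_nonneg:
  assumes "p \<ge> 0" "\<beta> > 0"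
  shows "bell_fun p \<beta> \<ge> 0"
  unfolding bell_fun_def
  using assms by (intro mult_nonneg_nonneg suminf_nonneg summable_bell) auto

lemma bell_fun_le:
  fixes p \<beta> :: real
  assumes "p \<ge> 0" "\<beta> > 0"
  shows "bell_fun p \<beta> \<le> \<beta> powr p * exp (\<beta> * (exp (p / \<beta>) - 1) - p)"
proof -
  have "(\<Sum>k. real k powr p * \<beta> ^ k / fact k) \<le> \<beta> powr p * exp (- p) * exp (\<beta> * exp (p / \<beta>))"
    using suminf_le[OF bell_term_le[OF assms] summable_bell[OF assms]
        sums_summable[OF exp_power_series_sums]] sums_unique[OF exp_power_series_sums] by simp
  then have "bell_fun p \<beta> \<le> exp (- \<beta>) * (\<beta> powr p * exp (- p) * exp (\<beta> * exp (p / \<beta>)))"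
    unfolding bell_fun_def by (intro mult_left_mono) auto
  also have "\<dots> = \<beta> powr p * exp (\<beta> * (exp (p / \<beta>) - 1) - p)"
    by (simp add: algebra_simps flip: exp_add)
  finally show ?thesis .
qed

text \<open>By convexity, \<open>exp\<close> lies below its chord over \<open>[0, a]\<close>. With
  \<open>a = 2\<close> this compares \<open>(exp t - 1) / t\<close> with its value at
  \<open>2\<close>.\<close>

lemma exp_le_chord:
  fixes t a :: real
  assumes "0 \<le> t" "t \<le> a" "a > 0"
  shows "exp t - 1 \<le> t * ((exp a - 1) / a)"
proof -
  have tangent: "exp t * (1 + (s - t)) \<le> exp s" for s
    using mult_left_mono[OF exp_ge_add_one_self[of "s - t"], of "exp t"]
    by (simp flip: exp_add)
  \<comment> \<open>The tangent at \<open>t\<close> is evaluated at \<open>a\<close> and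
    \<open>0\<close> with weights \<open>t\<close> and \<open>a - t\<close>; the slope terms cancel
    and the left side is \<open>a * exp t\<close>.\<close>
  have "t * (exp t * (1 + (a - t))) + (a - t) * (exp t * (1 + (0 - t))) \<le> t * exp a + (a - t) * exp 0"
    using assms by (intro add_mono mult_left_mono tangent) auto
  then show ?thesis using assms by (simp add: field_simps)
qed

theorem proposition5p2:
  fixes p \<beta> :: real
  assumes "p \<ge> 1" and "\<beta> > 0" and "p / \<beta> \<le> 2"
  shows "bell_fun p \<beta> powr (1 / p) \<le> K_plus * \<beta>"
proof -
  have "exp (p / \<beta>) - 1 \<le> p / \<beta> * ((exp 2 - 1) / 2)"
    using assms by (intro exp_le_chord) auto
  then have "\<beta> * (exp (p / \<beta>) - 1) \<le> p * ((exp 2 - 1) / 2)"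
    using assms by (simp add: field_simps)
  then have exponent: "\<beta> * (exp (p / \<beta>) - 1) - p \<le> p * ((exp 2 - 3) / 2)"
    by (simp add: field_simps)
  have "bell_fun p \<beta> \<le> \<beta> powr p * exp (\<beta> * (exp (p / \<beta>) - 1) - p)"
    using assms by (intro bell_fun_le) auto
  also have "\<dots> \<le> \<beta> powr p * exp (p * ((exp 2 - 3) / 2))"
    using exponent by (intro mult_left_mono) auto
  also have "\<dots> = (K_plus * \<beta>) powr p"
    using assms by (simp add: K_plus_def powr_mult exp_powr_real mult_ac flip: exp_double)
  finally have "bell_fun p \<beta> powr (1 / p) \<le> ((K_plus * \<beta>) powr p) powr (1 / p)"
    using assms bell_fun_nonneg by (intro powr_mono2) auto
  also have "\<dots> = K_plus * \<beta>"
    using assms by (simp add: powr_powr K_plus_def)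
  finally show ?thesis .
qed

end
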